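(* Let $f:\mathbb{R}^{m\times n}\to\mathbb{R}$ be convex, and let $W_0,W^\star\in\mathbb{R}^{m\times n}$ satisfy $\|W_0-W^\star\|_{\rm op}\le R$. Assume that there exists $G>0$ such that $|f(X)-f(Y)|\le G\|X-Y\|_{\rm op}$ for any $X,Y\in\mathbb{R}^{m\times n}$ satisfying $\|X-W^\star\|_{\rm op}\le R$ and $\|Y-W^\star\|_{\rm op}\le R$. If the MAGD algorithm (defined in the context, with first-order information $G_t\in\partial f(W_t)$) is run from $W_0$ with $$\bar\eta_t>0,\qquad \eta_t=\begin{cases}\bar\eta_t/\|G_t\|_F,&G_t\ne0,\\0,&G_t=0,\end{cases}\qquad\text{and}\qquad 0\le\eta_t^{\rm M}\le\frac{\bar\eta_t}{2\sqrt{\min\{m,n\}}},$$ then, for every $t\ge1$, $$\min_{0\le s<t}f(W_s)-f(W^\star)\le\frac{G}{2\sum_{s=0}^{t-1}\bar\eta_s}\left[\min\{m,n\}R^2+\frac2\gamma\log(1/\rho)+\sum_{s<t}\bar\eta_s^2+\gamma\sum_{s<t}\bar\eta_s^2\Big(\sum_{q=0}^{s-1}\bar\eta_q\Big)^2\right].$$ As a consequence, for any $\epsilon>0$, if we choose $T:=\left\lceil4\min\{m,n\}\left(\frac{GR}{\epsilon}\right)^2\right\rceil$, $\gamma:=3/(\min\{m,n\}R^2T)$, $\rho:=\exp(-3/(2T))$, $\bar\eta_t=R\sqrt{\min\{m,n\}/T}$, and $\eta_t^{\rm M}\in[0,R/(2\sqrt T)]$, then the MAGD algorithm visits a time step $\hat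 t\in\operatorname{argmin}_{0\le t<T}f(W_t)$ such that $f(W_{\hat t})-f(W^\star)\le\epsilon$, and the number of subgradient evaluations is $$O\left(\min\{m,n\}\left(\frac{GR}{\epsilon}\right)^2\right).$$
   Context: $\|\cdot\|_{\rm op}$ is the operator (spectral) norm, $\|\cdot\|_F$ the Frobenius norm, $\langle\cdot,\cdot\rangle$ the Frobenius inner product, and $\partial f$ the convex subdifferential (which coincides with the Clarke subdifferential for convex $f$). Inexact polar map: for $\delta\in[0,1)$ and $Z\in\mathbb{R}^{m\times n}$ with $\|Z\|_F\le1$ and $r=\operatorname{rank}(Z)$, set $\operatorname{polar}_\delta(0):=\{0\}$ and, for $Z\ne0$, let $\operatorname{polar}_\delta(Z)$ be the set of all matrices $U\operatorname{Diag}(\phi_1,\dots,\phi_r)V^\top$ such that $Z=U\operatorname{Diag}(\sigma_1,\dots,\sigma_r)V^\top$ is a compact SVD of $Z$, $0\le\phi_j\le1+\delta$ for every $j$, and $\phi_j\ge1-\delta$ whenever $\sigma_j\ge\delta$. MAGD algorithm (Muon Advised by Gradient Descent). Inputs: $W_0\in\mathbb{R}^{m\times n}$, $\eta_t\ge0$, $\gamma>0$, $\rho\in(0,1)$, $\beta_t^{\rm M}\in[0,1]$, $\eta_t^{\rm M}\ge0$, $\delta_t^{\rm M}\in[0,1)$, $\sigma_t^{\rm M}\ge0$. Initialization: $U_0=S_0=W_0$, $M_0=0$, $z_0=\log(\rho/(1-\rho))$. For $t=0,1,\dots$: $$\alpha_t=(1+e^{-z_t})^{-1},\qquad W_t=(1-\alpha_t)U_t+\alpha_tS_t,\qquad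 G_t\in\partial f(W_t),$$ $$z_{t+1}=z_t-\gamma\eta_t\langle G_t,S_t-U_t\rangle,\qquad S_{t+1}=S_t-\eta_tG_t,\qquad M_{t+1}=\beta_t^{\rm M}M_t+(1-\beta_t^{\rm M})G_t,$$ $$U_{t+1}\in U_t-\eta_t^{\rm M}\operatorname{polar}_{\delta_t^{\rm M}}\left(\frac{M_{t+1}}{\|M_{t+1}\|_F+\sigma_t^{\rm M}}\right),\quad\text{with }\tfrac00:=0.$$ (The matrices $G_t$ are distinct from the Lipschitz constant $G$.) *)

theory Defs
  imports "HOL-Analysis.Analysis" "HOL-Library.Landau_Symbols"
begin

text \<open>
  An m-by-n real matrix is an element of \<open>real ^ 'n ^ 'm\<close>.  On this type the library norm \<open>norm\<close>
  is the Frobenius norm and the library inner product \<open>\<bullet>\<close> is the Frobenius inner product.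
\<close>

definition op_norm :: "real ^ 'n ^ 'm \<Rightarrow> real" where
  "op_norm A = onorm ((*v) A)"

definition subdiff :: "('a::real_inner \<Rightarrow> real) \<Rightarrow> 'a \<Rightarrow> 'a set" where
  "subdiff f x = {g. \<forall>y. f y \<ge> f x + g \<bullet> (y - x)}"

text \<open>
  The inner dimension \<open>r\<close> of a factorization \<open>U Diag(\<phi>) V\<^sup>T\<close> depends on the matrix, so the
  \<open>r\<close> columns of \<open>U\<close> and of \<open>V\<close> are given as families of vectors indexed by \<open>{..<r}\<close>.
\<close>

definition orthonormal_cols :: "nat \<Rightarrow> (nat \<Rightarrow> 'a::real_inner) \<Rightarrow> bool" where
  "orthonormal_cols r u \<longleftrightarrow> (\<forall>i<r. \<forall>j<r. u i \<bullet> u j = (if i = j then 1 else 0))"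

definition UDiagVT ::
  "nat \<Rightarrow> (nat \<Rightarrow> real ^ 'm) \<Rightarrow> (nat \<Rightarrow> real) \<Rightarrow> (nat \<Rightarrow> real ^ 'n) \<Rightarrow> real ^ 'n ^ 'm" where
  "UDiagVT r u \<phi> v = (\<chi> i k. \<Sum>j<r. u j $ i * \<phi> j * v j $ k)"

definition compact_svd ::
  "real ^ 'n ^ 'm \<Rightarrow> (nat \<Rightarrow> real ^ 'm) \<Rightarrow> (nat \<Rightarrow> real) \<Rightarrow> (nat \<Rightarrow> real ^ 'n) \<Rightarrow> bool" where
  "compact_svd Z u \<sigma> v \<longleftrightarrow>
     orthonormal_cols (rank Z) u \<and> orthonormal_cols (rank Z) v \<and>
     (\<forall>j<rank Z. 0 < \<sigma> j) \<and> (\<forall>i j. i \<le> j \<and> j < rank Z \<longrightarrow> \<sigma> j \<le> \<sigma> i) \<and>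
     Z = UDiagVT (rank Z) u \<sigma> v"

text \<open>The inexact polar map; it is only applied with \<open>0 \<le> \<delta> < 1\<close> and \<open>norm Z \<le> 1\<close>.\<close>

definition polar :: "real \<Rightarrow> real ^ 'n ^ 'm \<Rightarrow> (real ^ 'n ^ 'm) set" where
  "polar \<delta> Z =
     (if Z = 0 then {0}
      else {UDiagVT (rank Z) u \<phi> v | u \<phi> v. \<exists>\<sigma>. compact_svd Z u \<sigma> v \<and>
              (\<forall>j<rank Z. 0 \<le> \<phi> j \<and> \<phi> j \<le> 1 + \<delta> \<and> (\<delta> \<le> \<sigma> j \<longrightarrow> 1 - \<delta> \<le> \<phi> j))})"

definition magd_inputs ::
  "(nat \<Rightarrow> real) \<Rightarrow> real \<Rightarrow> real \<Rightarrow> (nat \<Rightarrow> real) \<Rightarrow> (nat \<Rightarrow> real) \<Rightarrow> (nat \<Rightarrow> real) \<Rightarrow> (nat \<Rightarrow> real) \<Rightarrow> bool"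
  where
  "magd_inputs \<eta> \<gamma> \<rho> \<beta>M \<eta>M \<delta>M \<sigma>M \<longleftrightarrow>
     (\<forall>t. 0 \<le> \<eta> t) \<and> 0 < \<gamma> \<and> 0 < \<rho> \<and> \<rho> < 1 \<and>
     (\<forall>t. 0 \<le> \<beta>M t \<and> \<beta>M t \<le> 1) \<and> (\<forall>t. 0 \<le> \<eta>M t) \<and>
     (\<forall>t. 0 \<le> \<delta>M t \<and> \<delta>M t < 1) \<and> (\<forall>t. 0 \<le> \<sigma>M t)"

text \<open>
  \<open>magd_run f W0 \<eta> \<gamma> \<rho> \<beta>M \<eta>M \<delta>M \<sigma>M W g calls\<close>: some execution of MAGD on \<open>f\<close> started at \<open>W0\<close> has the
  iterates \<open>W t\<close>, receives the subgradients \<open>g t\<close>, and has made \<open>calls t\<close> subgradient evaluations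
  before iteration \<open>t\<close>, i.e. in the iterations \<open>0, \<dots>, t - 1\<close>; each iteration makes exactly one
  evaluation, at \<open>W t\<close>.  The convention 0/0 = 0 in the argument of the polar map is the one of
  \<open>/\<^sub>R\<close>: the divisor vanishes only if \<open>M (Suc t) = 0\<close>.
\<close>

definition magd_run ::
  "(real ^ 'n ^ 'm \<Rightarrow> real) \<Rightarrow> real ^ 'n ^ 'm \<Rightarrow>
   (nat \<Rightarrow> real) \<Rightarrow> real \<Rightarrow> real \<Rightarrow> (nat \<Rightarrow> real) \<Rightarrow> (nat \<Rightarrow> real) \<Rightarrow> (nat \<Rightarrow> real) \<Rightarrow> (nat \<Rightarrow> real) \<Rightarrow>
   (nat \<Rightarrow> real ^ 'n ^ 'm) \<Rightarrow> (nat \<Rightarrow> real ^ 'n ^ 'm) \<Rightarrow> (nat \<Rightarrow> nat) \<Rightarrow> bool" where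
  "magd_run f W0 \<eta> \<gamma> \<rho> \<beta>M \<eta>M \<delta>M \<sigma>M W g calls \<longleftrightarrow>
     magd_inputs \<eta> \<gamma> \<rho> \<beta>M \<eta>M \<delta>M \<sigma>M \<and>
     (\<exists>U S M z \<alpha>.
        U 0 = W0 \<and> S 0 = W0 \<and> M 0 = 0 \<and> z 0 = ln (\<rho> / (1 - \<rho>)) \<and> calls 0 = 0 \<and>
        (\<forall>t. \<alpha> t = inverse (1 + exp (- z t)) \<and>
             W t = (1 - \<alpha> t) *\<^sub>R U t + \<alpha> t *\<^sub>R S t \<and>
             g t \<in> subdiff f (W t) \<and>
             calls (Suc t) = calls t + 1 \<and>
             z (Suc t) = z t - \<gamma> * \<eta> t * (g t \<bullet> (S t - U t)) \<and>
             S (Suc t) = S t - \<eta> t *\<^sub>R g t \<and>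
             M (Suc t) = \<beta>M t *\<^sub>R M t + (1 - \<beta>M t) *\<^sub>R g t \<and>
             (\<exists>P \<in> polar (\<delta>M t) (M (Suc t) /\<^sub>R (norm (M (Suc t)) + \<sigma>M t)).
                U (Suc t) = U t - \<eta>M t *\<^sub>R P)))"

definition normalized_steps ::
  "(nat \<Rightarrow> real) \<Rightarrow> (nat \<Rightarrow> 'a::real_normed_vector) \<Rightarrow> (nat \<Rightarrow> real) \<Rightarrow> bool" where
  "normalized_steps \<eta>bar g \<eta> \<longleftrightarrow>
     (\<forall>t. 0 < \<eta>bar t \<and> \<eta> t = (if g t \<noteq> 0 then \<eta>bar t / norm (g t) else 0))"

text \<open>
  The number of iterations as a function of all four parameters, so that a bound
  \<open>O(d (G R / \<epsilon>)\<^sup>2)\<close>, taken along the filter \<open>d (G R / \<epsilon>)\<^sup>2 \<rightarrow> \<infinity>\<close>, has an absolute constant that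
  depends neither on the dimension nor on \<open>G\<close>, \<open>R\<close>.  The horizon is at least 1 for nonzero
  arguments, hence not bounded by a multiple of \<open>d (G R / \<epsilon>)\<^sup>2\<close> when the latter tends to 0.
\<close>

definition magd_horizon :: "nat \<Rightarrow> real \<Rightarrow> real \<Rightarrow> real \<Rightarrow> nat" where
  "magd_horizon d G R \<epsilon> = nat \<lceil>4 * real d * (G * R / \<epsilon>)\<^sup>2\<rceil>"

end

theory Submission
  imports Defs "HOL-Probability.Hoeffding"
begin

text \<open>
  Write \<open>h t = sgn (g t)\<close> and \<open>x t = \<eta>bar t * (h t \<bullet> (S t - U t))\<close>.  Since
  \<open>W t = S t - (1 - \<alpha> t) (S t - U t)\<close>, the weighted sum of \<open>h t \<bullet> (W t - Wst)\<close> splits into the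
  regret of the normalized subgradient iterates \<open>S\<close> and the sum of \<open>- (1 - \<alpha> t) x t\<close>.  The latter
  telescopes along the potential \<open>ln (1 + exp (- z t))\<close>, which starts at \<open>ln (1 / \<rho>)\<close> and has
  second derivative at most 1/4; the error \<open>\<gamma> (x t)\<^sup>2 / 8\<close> is controlled because \<open>S\<close> and \<open>U\<close> both
  drift from \<open>W0\<close> by at most the sum of the \<open>\<eta>bar\<close>.  Hence some iterate has
  \<open>h t \<bullet> (W t - Wst) \<le> b\<close>, where \<open>G b\<close> is the claimed bound.  If \<open>b \<le> R\<close>, this gives
  \<open>f (W t) - f Wst \<le> G b\<close>; if \<open>b > R\<close>, the iterate \<open>W 0 = W0\<close> already satisfies the claim.
\<close>

section \<open>Operator norm versus Frobenius norm\<close>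

lemma op_norm_nonneg: "0 \<le> op_norm A"
  by (simp add: op_norm_def onorm_pos_le)

text \<open>Row \<open>i\<close> itself serves as the test vector: coordinate \<open>i\<close> of
  its image is its squared norm.\<close>

lemma norm_matrix_row_le_op_norm:
  fixes A :: "real ^ 'n ^ 'm"
  shows "norm (A $ i) \<le> op_norm A"
proof (cases "A $ i = 0")
  case True
  then show ?thesis by (simp add: op_norm_nonneg)
next
  case False
  have "norm (A $ i) * norm (A $ i) = (A *v (A $ i)) $ i"
    by (simp add: matrix_vector_mul_component dot_square_norm power2_eq_square)
  also have "\<dots> \<le> norm (A *v (A $ i))"
    using component_le_norm_cart[of "A *v (A $ i)" i] by linarith
  also have "\<dots> \<le> op_norm A * norm (A $ i)"
    unfolding op_norm_def by (rule onorm) simp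
  finally show ?thesis using False by simp
qed

lemma norm_matrix_column_le_op_norm:
  fixes A :: "real ^ 'n ^ 'm"
  shows "norm (column k A) \<le> op_norm A"
  using onorm[OF matrix_vector_mul_bounded_linear[of A], of "axis k 1"]
  by (simp add: op_norm_def matrix_vector_mult_basis)

lemma norm_matrix_squared_rows:
  fixes A :: "real ^ 'n ^ 'm"
  shows "(norm A)\<^sup>2 = (\<Sum>i\<in>UNIV. (norm (A $ i))\<^sup>2)"
  by (simp add: norm_vec_def L2_set_def sum_nonneg)

lemma norm_matrix_squared_columns:
  fixes A :: "real ^ 'n ^ 'm"
  shows "(norm A)\<^sup>2 = (\<Sum>k\<in>UNIV. (norm (column k A))\<^sup>2)"
proof -
  have "(norm A)\<^sup>2 = (\<Sum>i\<in>UNIV. \<Sum>k\<in>UNIV. (A $ i $ k)\<^sup>2)"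
    by (simp add: norm_vec_def L2_set_def sum_nonneg)
  also have "\<dots> = (\<Sum>k\<in>UNIV. \<Sum>i\<in>UNIV. (A $ i $ k)\<^sup>2)"
    by (rule sum.swap)
  finally show ?thesis
    by (simp add: norm_vec_def L2_set_def sum_nonneg column_def)
qed

text \<open>The squared Frobenius norm splits over rows and also over columns, each piece being at
  most the squared operator norm. The shorter of the two sums gives the dimension factor, with no
  recourse to singular values.\<close>

lemma norm_squared_le_op_norm:
  fixes A :: "real ^ 'n ^ 'm"
  shows "(norm A)\<^sup>2 \<le> real (min CARD('m) CARD('n)) * (op_norm A)\<^sup>2"
proof -
  have "(norm A)\<^sup>2 \<le> (\<Sum>i\<in>(UNIV::'m set). (op_norm A)\<^sup>2)"
    unfolding norm_matrix_squared_rows[of A]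
    by (intro sum_mono power_mono norm_matrix_row_le_op_norm) simp
  moreover have "(norm A)\<^sup>2 \<le> (\<Sum>k\<in>(UNIV::'n set). (op_norm A)\<^sup>2)"
    unfolding norm_matrix_squared_columns[of A]
    by (intro sum_mono power_mono norm_matrix_column_le_op_norm) simp
  ultimately show ?thesis by (simp add: min_def)
qed

text \<open>Cauchy-Schwarz in each row. Through this, a short Frobenius displacement from
  \<open>Wst\<close> stays in the operator-norm ball on which the Lipschitz bound holds.\<close>

lemma op_norm_le_norm:
  fixes A :: "real ^ 'n ^ 'm"
  shows "op_norm A \<le> norm A"
  unfolding op_norm_def
proof (rule onorm_le)
  fix x :: "real ^ 'n"
  have "(norm (A *v x))\<^sup>2 = (\<Sum>i\<in>UNIV. ((A $ i) \<bullet> x)\<^sup>2)"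
    by (simp add: norm_vec_def L2_set_def sum_nonneg matrix_vector_mul_component)
  also have "\<dots> \<le> (\<Sum>i\<in>UNIV. (norm (A $ i) * norm x)\<^sup>2)"
    by (intro sum_mono) (metis Cauchy_Schwarz_ineq2 power2_abs power_mono abs_ge_zero)
  also have "\<dots> = (norm A * norm x)\<^sup>2"
    by (simp add: norm_matrix_squared_rows power_mult_distrib sum_distrib_right)
  finally show "norm (A *v x) \<le> norm A * norm x"
    by (rule power2_le_imp_le) simp
qed

lemma op_norm_zero [simp]: "op_norm (0 :: real ^ 'n ^ 'm) = 0"
  using op_norm_le_norm[of "0 :: real ^ 'n ^ 'm"] op_norm_nonneg[of "0 :: real ^ 'n ^ 'm"] by simp

section \<open>Size of an inexact polar factor\<close>

text \<open>The rank-one matrices formed from \<open>u j\<close> and \<open>v j\<close> are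
  orthonormal for the Frobenius inner product, so this is Pythagoras.\<close>

lemma norm_UDiagVT:
  fixes u :: "nat \<Rightarrow> real ^ 'm" and v :: "nat \<Rightarrow> real ^ 'n"
  assumes "orthonormal_cols r u" "orthonormal_cols r v"
  shows "(norm (UDiagVT r u \<phi> v))\<^sup>2 = (\<Sum>j<r. (\<phi> j)\<^sup>2)"
proof -
  have "(norm (UDiagVT r u \<phi> v))\<^sup>2
      = (\<Sum>i\<in>UNIV. \<Sum>k\<in>UNIV. \<Sum>p<r. \<Sum>q<r. (u p $ i * \<phi> p * v p $ k) * (u q $ i * \<phi> q * v q $ k))"
    by (simp add: power2_norm_eq_inner inner_vec_def UDiagVT_def sum_product)
  \<comment> \<open>Four exchanges move \<open>p\<close> and \<open>q\<close> outside; the sums over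
    \<open>i\<close> and \<open>k\<close> then factor into \<open>u p \<bullet> u q\<close> and
    \<open>v p \<bullet> v q\<close>.\<close>
  also have "\<dots> = (\<Sum>i\<in>UNIV. \<Sum>p<r. \<Sum>k\<in>UNIV. \<Sum>q<r. (u p $ i * \<phi> p * v p $ k) * (u q $ i * \<phi> q * v q $ k))"
    by (intro sum.cong refl sum.swap)
  also have "\<dots> = (\<Sum>p<r. \<Sum>i\<in>UNIV. \<Sum>k\<in>UNIV. \<Sum>q<r. (u p $ i * \<phi> p * v p $ k) * (u q $ i * \<phi> q * v q $ k))"
    by (rule sum.swap)
  also have "\<dots> = (\<Sum>p<r. \<Sum>i\<in>UNIV. \<Sum>q<r. \<Sum>k\<in>UNIV. (u p $ i * \<phi> p * v p $ k) * (u q $ i * \<phi> q * v q $ k))"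
    by (intro sum.cong refl sum.swap)
  also have "\<dots> = (\<Sum>p<r. \<Sum>q<r. \<Sum>i\<in>UNIV. \<Sum>k\<in>UNIV. (u p $ i * \<phi> p * v p $ k) * (u q $ i * \<phi> q * v q $ k))"
    by (intro sum.cong refl sum.swap)
  also have "\<dots> = (\<Sum>p<r. \<Sum>q<r. \<phi> p * \<phi> q * (u p \<bullet> u q) * (v p \<bullet> v q))"
    by (intro sum.cong refl)
      (simp add: inner_vec_def sum_product sum_distrib_left sum_distrib_right mult_ac)
  also have "\<dots> = (\<Sum>p<r. \<Sum>q<r. if q = p then (\<phi> p)\<^sup>2 else 0)"
    using assms by (intro sum.cong refl) (auto simp: orthonormal_cols_def power2_eq_square)
  finally show ?thesis by simp
qed

text \<open>The rank bounds the number of coefficients by the smaller dimension, and each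
  coefficient lies in [0, 2] because \<open>\<delta> < 1\<close>. This explains the denominator in
  the cap on \<open>\<eta>M\<close>.\<close>

lemma norm_polar_le:
  fixes Z :: "real ^ 'n ^ 'm"
  assumes "P \<in> polar \<delta> Z" "0 \<le> \<delta>" "\<delta> < 1"
  shows "norm P \<le> 2 * sqrt (real (min CARD('m) CARD('n)))"
proof (cases "Z = 0")
  case True
  with assms show ?thesis by (simp add: polar_def)
next
  case False
  with assms(1) obtain u \<phi> v \<sigma> where P: "P = UDiagVT (rank Z) u \<phi> v"
    and "compact_svd Z u \<sigma> v" and \<phi>: "\<And>j. j < rank Z \<Longrightarrow> 0 \<le> \<phi> j \<and> \<phi> j \<le> 1 + \<delta>"
    unfolding polar_def by auto
  then have "(norm P)\<^sup>2 = (\<Sum>j<rank Z. (\<phi> j)\<^sup>2)"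
    unfolding P by (intro norm_UDiagVT) (auto simp: compact_svd_def)
  also have "\<dots> \<le> (\<Sum>j<rank Z. 2\<^sup>2)"
  proof (intro sum_mono power_mono)
    fix j assume "j \<in> {..<rank Z}"
    with \<phi>[of j] assms(3) show "\<phi> j \<le> 2" "0 \<le> \<phi> j" by auto
  qed
  also have "\<dots> \<le> (2 * sqrt (real (min CARD('m) CARD('n))))\<^sup>2"
    using rank_bound[of Z] by (simp add: power_mult_distrib del: of_nat_min)
  finally show ?thesis by (rule power2_le_imp_le) simp
qed

section \<open>The logistic potential\<close>

text \<open>Hoeffding's lemma for a Bernoulli variable with success probability \<open>p\<close>,
  whose log moment generating function is the left side. For negative \<open>y\<close>, exchanging
  the two outcomes replaces \<open>p\<close> by \<open>1 - p\<close> and \<open>y\<close> by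
  \<open>- y\<close>.\<close>

lemma ln_bernoulli_mgf_le:
  fixes p y :: real
  assumes "0 \<le> p" "p \<le> 1"
  shows "ln (1 + p * (exp y - 1)) \<le> p * y + y\<^sup>2 / 8"
proof (cases "0 \<le> y")
  case True
  then show ?thesis using Hoeffdings_lemma_aux[of y p] assms by (simp add: mult.commute)
next
  case False
  have "0 \<le> (1 - p) * (exp (- y) - 1)" using False assms by simp
  then have pos: "0 < 1 + (1 - p) * (exp (- y) - 1)" by linarith
  have "1 + p * (exp y - 1) = exp y * (1 + (1 - p) * (exp (- y) - 1))"
    by (simp add: algebra_simps flip: exp_add)
  then have "ln (1 + p * (exp y - 1)) = y + ln (1 + (1 - p) * (exp (- y) - 1))"
    using pos by (simp add: ln_mult)
  then show ?thesis
    using Hoeffdings_lemma_aux[of "- y" "1 - p"] False assms by (simp add: algebra_simps)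
qed

text \<open>The new value of \<open>1 + exp (- z)\<close> divided by the old one is the Bernoulli
  moment generating function at \<open>y\<close> with success probability
  \<open>1 - \<alpha>\<close>, so Hoeffding's bound controls the increment of the potential.\<close>

lemma softplus_step_le:
  fixes z y :: real
  defines "\<alpha> \<equiv> inverse (1 + exp (- z))"
  shows "ln (1 + exp (- (z - y))) \<le> ln (1 + exp (- z)) + (1 - \<alpha>) * y + y\<^sup>2 / 8"
proof -
  have pos: "0 < 1 + exp (- z)" by (simp add: add_pos_pos)
  have \<alpha>: "0 \<le> 1 - \<alpha>" "1 - \<alpha> \<le> 1"
    using pos by (auto simp: \<alpha>_def field_simps)
  have e: "(1 + exp (- z)) * (1 - \<alpha>) = exp (- z)"
    using pos by (simp add: \<alpha>_def field_simps)
  have "(1 + exp (- z)) * (1 + (1 - \<alpha>) * (exp y - 1))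
      = 1 + exp (- z) + ((1 + exp (- z)) * (1 - \<alpha>)) * (exp y - 1)"
    by (simp add: algebra_simps)
  also have "\<dots> = 1 + exp (- (z - y))"
    unfolding e by (simp add: algebra_simps flip: exp_add)
  finally have eq: "(1 + exp (- z)) * (1 + (1 - \<alpha>) * (exp y - 1)) = 1 + exp (- (z - y))" .
  have "0 < (1 + exp (- z)) * (1 + (1 - \<alpha>) * (exp y - 1))"
    unfolding eq by (simp add: add_pos_pos)
  then have "0 < 1 + (1 - \<alpha>) * (exp y - 1)"
    using pos by (simp add: zero_less_mult_iff)
  then have "ln (1 + exp (- (z - y))) = ln (1 + exp (- z)) + ln (1 + (1 - \<alpha>) * (exp y - 1))"
    unfolding eq[symmetric] using pos by (simp add: ln_mult)
  with ln_bernoulli_mgf_le[OF \<alpha>, of y] show ?thesis by simp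
qed

text \<open>Telescopes the potential with \<open>y = \<gamma> * x t\<close>, drops its nonnegative
  final value and divides by \<open>\<gamma>\<close>.\<close>

lemma logistic_regret_le:
  fixes z x \<alpha> :: "nat \<Rightarrow> real"
  assumes "0 < \<gamma>" "0 < \<rho>" "\<rho> < 1"
    and "z 0 = ln (\<rho> / (1 - \<rho>))"
    and "\<And>t. z (Suc t) = z t - \<gamma> * x t"
    and "\<And>t. \<alpha> t = inverse (1 + exp (- z t))"
  shows "- (\<Sum>s<t. (1 - \<alpha> s) * x s) \<le> ln (1 / \<rho>) / \<gamma> + \<gamma> / 8 * (\<Sum>s<t. (x s)\<^sup>2)"
proof -
  \<comment> \<open>Here \<open>exp (- z 0)\<close> equals
    \<open>(1 - \<rho>) / \<rho>\<close>.\<close>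
  have z0: "ln (1 + exp (- z 0)) = ln (1 / \<rho>)"
    using assms(2,3) by (simp add: assms(4) exp_minus field_simps)
  have step: "ln (1 + exp (- z t)) \<le>
      ln (1 / \<rho>) + \<gamma> * (\<Sum>s<t. (1 - \<alpha> s) * x s) + \<gamma>\<^sup>2 / 8 * (\<Sum>s<t. (x s)\<^sup>2)" for t
  proof (induction t)
    case (Suc t)
    with softplus_step_le[of "z t" "\<gamma> * x t"] show ?case
      by (simp add: assms(5) assms(6)[symmetric] algebra_simps power_mult_distrib)
  qed (simp add: z0)
  have "0 \<le> ln (1 + exp (- z t))" by (simp add: ln_ge_zero)
  with step[of t] have
    "0 \<le> (ln (1 / \<rho>) + \<gamma> * (\<Sum>s<t. (1 - \<alpha> s) * x s) + \<gamma>\<^sup>2 / 8 * (\<Sum>s<t. (x s)\<^sup>2)) / \<gamma>"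
    using \<open>0 \<le> ln (1 + exp (- z t))\<close> assms(1) by (intro divide_nonneg_pos) linarith+
  also have "\<dots> = ln (1 / \<rho>) / \<gamma> + (\<Sum>s<t. (1 - \<alpha> s) * x s) + \<gamma> / 8 * (\<Sum>s<t. (x s)\<^sup>2)"
    using assms(1) by (simp add: add_divide_distrib power2_eq_square)
  finally show ?thesis by simp
qed

section \<open>Regret of the interpolated iterates\<close>

text \<open>Expand the squared distance to \<open>x\<close> after each step, telescope, and drop the
  final distance. Directions of norm at most 1 include the zero direction, which arises from a
  vanishing subgradient.\<close>

lemma gradient_step_regret_le:
  fixes S h :: "nat \<Rightarrow> 'a::real_inner" and c :: "nat \<Rightarrow> real"
  assumes "\<And>t. S (Suc t) = S t - c t *\<^sub>R h t" "\<And>t. norm (h t) \<le> 1"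
  shows "2 * (\<Sum>s<t. c s * (h s \<bullet> (S s - x))) \<le> (norm (S 0 - x))\<^sup>2 + (\<Sum>s<t. (c s)\<^sup>2)"
proof -
  have "(norm (S t - x))\<^sup>2
      \<le> (norm (S 0 - x))\<^sup>2 - 2 * (\<Sum>s<t. c s * (h s \<bullet> (S s - x))) + (\<Sum>s<t. (c s)\<^sup>2)"
  proof (induction t)
    case (Suc t)
    have eq: "S (Suc t) - x = (S t - x) - c t *\<^sub>R h t" by (simp add: assms(1))
    have "(norm (S (Suc t) - x))\<^sup>2
        = (norm (S t - x))\<^sup>2 - 2 * (c t * (h t \<bullet> (S t - x))) + (c t)\<^sup>2 * (norm (h t))\<^sup>2"
      unfolding eq power2_norm_eq_inner
      by (simp add: inner_diff_left inner_diff_right inner_commute algebra_simps power2_eq_square)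
    moreover have "(c t)\<^sup>2 * (norm (h t))\<^sup>2 \<le> (c t)\<^sup>2"
      using assms(2)[of t] by (simp add: mult_left_le power_le_one)
    ultimately show ?case using Suc by simp
  qed simp
  then show ?thesis using zero_le_power2[of "norm (S t - x)"] by linarith
qed

lemma norm_diff_start_le:
  fixes X :: "nat \<Rightarrow> 'a::real_normed_vector"
  assumes "\<And>t. norm (X (Suc t) - X t) \<le> c t"
  shows "norm (X t - X 0) \<le> (\<Sum>q<t. c q)"
proof (induction t)
  case (Suc t)
  have "norm (X (Suc t) - X 0) \<le> norm (X (Suc t) - X t) + norm (X t - X 0)"
    by (rule norm_diff_triangle_ineq[of "X (Suc t)" "X t" "X t" "X 0", simplified])
  with Suc assms[of t] show ?case by simp
qed simp

text \<open>The update of \<open>U\<close> enters only through its step length, so the estimate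
  holds for any advised sequence that moves no faster than \<open>c\<close>.\<close>

lemma interpolated_regret_le:
  fixes W U S h :: "nat \<Rightarrow> 'a::real_inner" and c z \<alpha> :: "nat \<Rightarrow> real"
  assumes "0 < \<gamma>" "0 < \<rho>" "\<rho> < 1"
    and c: "\<And>t. 0 \<le> c t"
    and h: "\<And>t. norm (h t) \<le> 1"
    and start: "U 0 = S 0" "z 0 = ln (\<rho> / (1 - \<rho>))"
    and \<alpha>: "\<And>t. \<alpha> t = inverse (1 + exp (- z t))"
    and W: "\<And>t. W t = (1 - \<alpha> t) *\<^sub>R U t + \<alpha> t *\<^sub>R S t"
    and z: "\<And>t. z (Suc t) = z t - \<gamma> * (c t * (h t \<bullet> (S t - U t)))"
    and S: "\<And>t. S (Suc t) = S t - c t *\<^sub>R h t"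
    and U: "\<And>t. norm (U (Suc t) - U t) \<le> c t"
  shows "2 * (\<Sum>s<t. c s * (h s \<bullet> (W s - x)))
      \<le> (norm (S 0 - x))\<^sup>2 + 2 / \<gamma> * ln (1 / \<rho>) + (\<Sum>s<t. (c s)\<^sup>2)
        + \<gamma> * (\<Sum>s<t. (c s)\<^sup>2 * (\<Sum>q<s. c q)\<^sup>2)"
proof -
  let ?y = "\<lambda>s. c s * (h s \<bullet> (S s - U s))"
  have S_step: "norm (S (Suc t) - S t) \<le> c t" for t
    using h[of t] c[of t] by (simp add: S mult_left_le)
  \<comment> \<open>\<open>S\<close> and \<open>U\<close> share their starting point and each drifts
    by at most the sum, hence the factor 2.\<close>
  have dist: "norm (S s - U s) \<le> 2 * (\<Sum>q<s. c q)" for s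
  proof -
    have "norm (S s - U s) \<le> norm (S s - S 0) + norm (U s - U 0)"
      using norm_triangle_ineq4[of "S s - S 0" "U s - U 0"] by (simp add: start)
    also have "\<dots> \<le> 2 * (\<Sum>q<s. c q)"
      using norm_diff_start_le[of S c s, OF S_step] norm_diff_start_le[of U c s, OF U] by simp
    finally show ?thesis .
  qed
  have y: "(?y s)\<^sup>2 \<le> 4 * ((c s)\<^sup>2 * (\<Sum>q<s. c q)\<^sup>2)" for s
  proof -
    have "\<bar>h s \<bullet> (S s - U s)\<bar> \<le> norm (h s) * norm (S s - U s)"
      by (rule Cauchy_Schwarz_ineq2)
    also have "\<dots> \<le> 1 * (2 * (\<Sum>q<s. c q))"
      by (intro mult_mono h dist) auto
    finally have "\<bar>h s \<bullet> (S s - U s)\<bar>\<^sup>2 \<le> (2 * (\<Sum>q<s. c q))\<^sup>2"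
      by (intro power_mono) auto
    then have "(h s \<bullet> (S s - U s))\<^sup>2 \<le> 4 * (\<Sum>q<s. c q)\<^sup>2"
      by (simp add: power_mult_distrib)
    from mult_left_mono[OF this, of "(c s)\<^sup>2"] show ?thesis
      by (simp add: power_mult_distrib mult_ac)
  qed
  have "c s * (h s \<bullet> (W s - x)) = c s * (h s \<bullet> (S s - x)) - (1 - \<alpha> s) * ?y s" for s
    by (simp add: W inner_diff_right inner_add_right algebra_simps)
  then have "(\<Sum>s<t. c s * (h s \<bullet> (W s - x)))
      = (\<Sum>s<t. c s * (h s \<bullet> (S s - x))) - (\<Sum>s<t. (1 - \<alpha> s) * ?y s)"
    by (simp add: sum_subtractf)
  moreover have "- (\<Sum>s<t. (1 - \<alpha> s) * ?y s)
      \<le> ln (1 / \<rho>) / \<gamma> + \<gamma> / 8 * (\<Sum>s<t. (?y s)\<^sup>2)"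
    by (rule logistic_regret_le[OF assms(1-3) start(2) z \<alpha>])
  \<comment> \<open>The 4 from the squared drift meets the 1/8 of Hoeffding's lemma; doubling the
    resulting \<open>\<gamma> / 2\<close> gives the coefficient \<open>\<gamma>\<close> of the
    conclusion.\<close>
  moreover have "\<gamma> / 8 * (\<Sum>s<t. (?y s)\<^sup>2)
      \<le> \<gamma> / 8 * (\<Sum>s<t. 4 * ((c s)\<^sup>2 * (\<Sum>q<s. c q)\<^sup>2))"
    using assms(1) by (intro mult_left_mono sum_mono y) auto
  moreover have "\<dots> = \<gamma> * (\<Sum>s<t. (c s)\<^sup>2 * (\<Sum>q<s. c q)\<^sup>2) / 2"
    by (simp flip: sum_distrib_left)
  moreover have "2 / \<gamma> * ln (1 / \<rho>) = 2 * (ln (1 / \<rho>) / \<gamma>)"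
    by simp
  ultimately show ?thesis
    using gradient_step_regret_le[of S c h x t, OF S h] by linarith
qed

section \<open>From directional gaps to function values\<close>

text \<open>
  The point \<open>Wst + v *\<^sub>R sgn g\<close> lies on the hyperplane through \<open>X\<close> with normal \<open>g\<close>, where the
  subgradient inequality gives \<open>f \<ge> f X\<close>; the Lipschitz bound is thus only needed near \<open>Wst\<close>,
  and \<open>X\<close> itself may be far away.
\<close>

lemma subgradient_gap_le:
  fixes f :: "real ^ 'n ^ 'm \<Rightarrow> real"
  assumes g: "g \<in> subdiff f X" and "0 \<le> G"
    and lipschitz: "\<And>X Y. op_norm (X - Wst) \<le> R \<Longrightarrow> op_norm (Y - Wst) \<le> R \<Longrightarrow>
                      \<bar>f X - f Y\<bar> \<le> G * op_norm (X - Y)"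
    and v: "sgn g \<bullet> (X - Wst) \<le> b" and b: "0 \<le> b" "b \<le> R"
  shows "f X - f Wst \<le> G * b"
proof -
  let ?v = "sgn g \<bullet> (X - Wst)"
  have sub: "f y \<ge> f X + norm g * (sgn g \<bullet> (y - X))" for y
  proof -
    have "norm g * (sgn g \<bullet> (y - X)) = (norm g *\<^sub>R sgn g) \<bullet> (y - X)" by simp
    also have "norm g *\<^sub>R sgn g = g" by (cases "g = 0") (simp_all add: sgn_div_norm)
    finally show ?thesis using g by (simp add: subdiff_def)
  qed
  have Gb: "0 \<le> G * b" using assms(2) b by simp
  show ?thesis
  \<comment> \<open>In the first case the subgradient inequality at \<open>Wst\<close> alone gives
    \<open>f X \<le> f Wst\<close>. In the second, \<open>sgn g\<close> is a unit vector and
    \<open>?v\<close> lies between 0 and \<open>b\<close>, which keeps \<open>?Y\<close> in the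
    ball.\<close>
  proof (cases "g = 0 \<or> ?v \<le> 0")
    case True
    have "sgn g \<bullet> (Wst - X) = - ?v" by (simp add: inner_diff_right)
    with True have "0 \<le> norm g * (sgn g \<bullet> (Wst - X))"
      by (auto simp: mult_nonneg_nonpos)
    with sub[of Wst] Gb show ?thesis by linarith
  next
    case False
    let ?Y = "Wst + ?v *\<^sub>R sgn g"
    have n: "norm (sgn g) = 1" using False by (simp add: norm_sgn)
    then have "sgn g \<bullet> sgn g = 1" by (simp add: dot_square_norm)
    then have "sgn g \<bullet> (?Y - X) = 0" by (simp add: inner_diff_right inner_add_right)
    with sub[of ?Y] have "f X \<le> f ?Y" by simp
    moreover have Y: "op_norm (?Y - Wst) \<le> b"
      using op_norm_le_norm[of "?Y - Wst"] v n False by simp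
    moreover have "\<bar>f ?Y - f Wst\<bar> \<le> G * op_norm (?Y - Wst)"
      by (rule lipschitz) (use Y b in auto)
    moreover have "G * op_norm (?Y - Wst) \<le> G * b"
      using Y assms(2) by (intro mult_left_mono) auto
    ultimately show ?thesis by linarith
  qed
qed

lemma magd_best_iterate_le:
  fixes f :: "real ^ 'n ^ 'm \<Rightarrow> real"
  defines "d \<equiv> min CARD('m) CARD('n)"
  assumes dist: "op_norm (W0 - Wst) \<le> R" and G: "0 < G"
    and lipschitz: "\<And>X Y. op_norm (X - Wst) \<le> R \<Longrightarrow> op_norm (Y - Wst) \<le> R \<Longrightarrow>
                      \<bar>f X - f Y\<bar> \<le> G * op_norm (X - Y)"
    and run: "magd_run f W0 \<eta> \<gamma> \<rho> \<beta>M \<eta>M \<delta>M \<sigma>M W g calls"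
    and steps: "normalized_steps \<eta>bar g \<eta>"
    and \<eta>M: "\<And>t. 0 \<le> \<eta>M t \<and> \<eta>M t \<le> \<eta>bar t / (2 * sqrt (real d))"
    and t: "1 \<le> t"
  shows "(MIN s\<in>{..<t}. f (W s)) - f Wst
           \<le> G / (2 * (\<Sum>s<t. \<eta>bar s)) *
              (real d * R\<^sup>2 + 2 / \<gamma> * ln (1 / \<rho>) + (\<Sum>s<t. (\<eta>bar s)\<^sup>2)
               + \<gamma> * (\<Sum>s<t. (\<eta>bar s)\<^sup>2 * (\<Sum>q<s. \<eta>bar q)\<^sup>2))"
proof -
  let ?B = "real d * R\<^sup>2 + 2 / \<gamma> * ln (1 / \<rho>) + (\<Sum>s<t. (\<eta>bar s)\<^sup>2)
               + \<gamma> * (\<Sum>s<t. (\<eta>bar s)\<^sup>2 * (\<Sum>q<s. \<eta>bar q)\<^sup>2)"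
  let ?s = "\<Sum>s<t. \<eta>bar s"
  \<comment> \<open>Twice the sum of the weights times \<open>b\<close> is the regret bound
    \<open>?B\<close>, so \<open>b\<close> bounds the weighted average of the directional
    gaps.\<close>
  define b where "b = ?B / (2 * ?s)"
  have inputs: "0 < \<gamma>" "0 < \<rho>" "\<rho> < 1" "\<And>t. 0 \<le> \<delta>M t" "\<And>t. \<delta>M t < 1"
    using run unfolding magd_run_def magd_inputs_def by auto
  \<comment> \<open>The second identity also covers \<open>g t = 0\<close>, where both sides vanish
    since \<open>sgn 0 = 0\<close>.\<close>
  have \<eta>bar: "\<And>t. 0 < \<eta>bar t" and \<eta>: "\<And>t. \<eta> t *\<^sub>R g t = \<eta>bar t *\<^sub>R sgn (g t)"
    using steps unfolding normalized_steps_def by (auto simp: sgn_div_norm divide_inverse)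
  obtain U S M z \<alpha> where start: "U 0 = W0" "S 0 = W0" "z 0 = ln (\<rho> / (1 - \<rho>))"
    and iter: "\<And>t. \<alpha> t = inverse (1 + exp (- z t))"
      "\<And>t. W t = (1 - \<alpha> t) *\<^sub>R U t + \<alpha> t *\<^sub>R S t"
      "\<And>t. g t \<in> subdiff f (W t)"
      "\<And>t. z (Suc t) = z t - \<gamma> * \<eta> t * (g t \<bullet> (S t - U t))"
      "\<And>t. S (Suc t) = S t - \<eta> t *\<^sub>R g t"
      "\<And>t. \<exists>P \<in> polar (\<delta>M t) (M (Suc t) /\<^sub>R (norm (M (Suc t)) + \<sigma>M t)). U (Suc t) = U t - \<eta>M t *\<^sub>R P"
    using run unfolding magd_run_def by blast
  have d: "0 < d" by (simp add: d_def)
  \<comment> \<open>The cap on \<open>\<eta>M\<close> exactly cancels the bound on the polar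
    factor.\<close>
  have U: "norm (U (Suc t) - U t) \<le> \<eta>bar t" for t
  proof -
    obtain P where P: "P \<in> polar (\<delta>M t) (M (Suc t) /\<^sub>R (norm (M (Suc t)) + \<sigma>M t))"
      and "U (Suc t) = U t - \<eta>M t *\<^sub>R P"
      using iter(6) by blast
    then have "norm (U (Suc t) - U t) = \<eta>M t * norm P" using \<eta>M[of t] by simp
    also have "\<dots> \<le> \<eta>bar t / (2 * sqrt (real d)) * (2 * sqrt (real d))"
      using \<eta>M[of t] \<eta>bar[of t] norm_polar_le[OF P inputs(4,5)]
      by (intro mult_mono) (auto simp: d_def)
    finally show ?thesis using d by simp
  qed
  have z: "z (Suc t) = z t - \<gamma> * (\<eta>bar t * (sgn (g t) \<bullet> (S t - U t)))" for t
  proof -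
    have "\<eta> t * (g t \<bullet> (S t - U t)) = (\<eta> t *\<^sub>R g t) \<bullet> (S t - U t)" by simp
    then show ?thesis unfolding \<eta> iter(4) by simp
  qed
  have regret: "2 * (\<Sum>s<t. \<eta>bar s * (sgn (g s) \<bullet> (W s - Wst)))
      \<le> (norm (W0 - Wst))\<^sup>2 + 2 / \<gamma> * ln (1 / \<rho>) + (\<Sum>s<t. (\<eta>bar s)\<^sup>2)
        + \<gamma> * (\<Sum>s<t. (\<eta>bar s)\<^sup>2 * (\<Sum>q<s. \<eta>bar q)\<^sup>2)"
    using interpolated_regret_le[where h = "\<lambda>t. sgn (g t)" and c = \<eta>bar and U = U and S = S and z = z
        and \<alpha> = \<alpha> and W = W and \<gamma> = \<gamma> and \<rho> = \<rho> and t = t and x = Wst]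
      inputs \<eta>bar start iter U z
    by (simp add: \<eta> less_imp_le norm_sgn)
  have R: "0 \<le> R" using dist op_norm_nonneg[of "W0 - Wst"] by linarith
  have "(norm (W0 - Wst))\<^sup>2 \<le> real d * (op_norm (W0 - Wst))\<^sup>2"
    unfolding d_def by (rule norm_squared_le_op_norm)
  also have "\<dots> \<le> real d * R\<^sup>2"
    using dist by (intro mult_left_mono power_mono op_norm_nonneg) auto
  finally have sum_le: "2 * (\<Sum>s<t. \<eta>bar s * (sgn (g s) \<bullet> (W s - Wst))) \<le> ?B"
    using regret by linarith
  have s: "0 < ?s" using t \<eta>bar by (intro sum_pos) (auto simp: lessThan_empty_iff)
  have "0 \<le> ?B"
    using inputs by (intro add_nonneg_nonneg mult_nonneg_nonneg sum_nonneg) auto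
  then have b: "0 \<le> b" using s by (simp add: b_def)
  \<comment> \<open>If every gap exceeded \<open>b\<close>, the positive weights would push the
    weighted sum strictly above half of \<open>?B\<close>.\<close>
  obtain s where "s < t" and sb: "sgn (g s) \<bullet> (W s - Wst) \<le> b"
  proof (rule ccontr)
    assume "\<not> thesis"
    then have "b < sgn (g s) \<bullet> (W s - Wst)" if "s < t" for s using that \<open>\<And>s. _ \<Longrightarrow> _ \<Longrightarrow> thesis\<close> by force
    then have "(\<Sum>s<t. \<eta>bar s * b) < (\<Sum>s<t. \<eta>bar s * (sgn (g s) \<bullet> (W s - Wst)))"
      using t \<eta>bar by (intro sum_strict_mono) (auto simp: lessThan_empty_iff)
    moreover have "2 * (\<Sum>s<t. \<eta>bar s * b) = ?B"
    proof -
      have "2 * (\<Sum>s<t. \<eta>bar s * b) = 2 * ?s * b" by (simp add: sum_distrib_right)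
      then show ?thesis using s by (simp add: b_def)
    qed
    ultimately show False using sum_le by linarith
  qed
  have "\<exists>s<t. f (W s) - f Wst \<le> G * b"
  proof (cases "b \<le> R")
    case True
    with \<open>s < t\<close> show ?thesis
      using subgradient_gap_le[OF iter(3) _ lipschitz sb b] G by auto
  next
    case False
    have "W 0 = W0" using iter(2)[of 0] start by (simp flip: scaleR_add_left)
    moreover have "\<bar>f W0 - f Wst\<bar> \<le> G * op_norm (W0 - Wst)"
      by (rule lipschitz) (use dist R in auto)
    moreover have "G * op_norm (W0 - Wst) \<le> G * b"
      using dist False G by (intro mult_left_mono) auto
    ultimately show ?thesis using t by (intro exI[of _ 0]) auto
  qed
  then obtain s' where "s' < t" "f (W s') - f Wst \<le> G * b" by blast
  moreover have "(MIN s\<in>{..<t}. f (W s)) \<le> f (W s')" using \<open>s' < t\<close> by (intro Min_le) auto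
  ultimately have "(MIN s\<in>{..<t}. f (W s)) - f Wst \<le> G * b" by linarith
  then show ?thesis unfolding b_def times_divide_eq_left times_divide_eq_right .
qed

section \<open>Tuned parameters and the evaluation count\<close>

lemma sum_squares_lessThan_le: "(\<Sum>s<n. (real s)\<^sup>2) \<le> real n ^ 3 / 3"
proof (induction n)
  case (Suc n)
  have "real (Suc n) ^ 3 = real n ^ 3 + 3 * (real n)\<^sup>2 + 3 * real n + 1"
    by (simp add: power2_eq_square power3_eq_cube algebra_simps)
  with Suc show ?case by simp
qed simp

lemma magd_calls: "magd_run f W0 \<eta> \<gamma> \<rho> \<beta>M \<eta>M \<delta>M \<sigma>M W g calls \<Longrightarrow> calls t = t"
  unfolding magd_run_def by (induction t) auto

text \<open>The parameters balance the bracket: its first three terms equal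
  \<open>real d * R\<^sup>2\<close> and the fourth is at most that. The bound becomes
  \<open>2 * G * c\<close>, and the choice of \<open>T\<close> makes this at most
  \<open>\<epsilon>\<close>.\<close>

lemma magd_tuned_bound_le:
  fixes G R \<epsilon> :: real and d T :: nat
  defines "c \<equiv> R * sqrt (real d / real T)" and "\<gamma> \<equiv> 3 / (real d * R\<^sup>2 * real T)"
    and "\<rho> \<equiv> exp (- 3 / (2 * real T))"
  assumes pos: "0 < G" "0 < R" "0 < \<epsilon>" "0 < d" "0 < T"
    and T: "4 * real d * (G * R / \<epsilon>)\<^sup>2 \<le> real T"
  shows "G / (2 * (\<Sum>s<T. c)) * (real d * R\<^sup>2 + 2 / \<gamma> * ln (1 / \<rho>) + (\<Sum>s<T. c\<^sup>2)
           + \<gamma> * (\<Sum>s<T. c\<^sup>2 * (\<Sum>q<s. c)\<^sup>2)) \<le> \<epsilon>"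
proof -
  have c2: "c\<^sup>2 = R\<^sup>2 * real d / real T" by (simp add: c_def power_mult_distrib)
  have c: "0 < c" using pos by (simp add: c_def)
  have "ln (1 / \<rho>) = 3 / (2 * real T)" by (simp add: \<rho>_def ln_div)
  then have 1: "2 / \<gamma> * ln (1 / \<rho>) = real d * R\<^sup>2" using pos by (simp add: \<gamma>_def field_simps)
  have 2: "(\<Sum>s<T. c\<^sup>2) = real d * R\<^sup>2" using pos by (simp add: c2)
  \<comment> \<open>The inner sum is \<open>real s * c\<close>; the 1/3 from the sum of squares then
    cancels the 3 in \<open>\<gamma>\<close>.\<close>
  have "\<gamma> * (\<Sum>s<T. c\<^sup>2 * (\<Sum>q<s. c)\<^sup>2) = \<gamma> * (c\<^sup>2 * c\<^sup>2) * (\<Sum>s<T. (real s)\<^sup>2)"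
    by (simp add: power_mult_distrib sum_distrib_left mult_ac)
  also have "\<dots> \<le> \<gamma> * (c\<^sup>2 * c\<^sup>2) * (real T ^ 3 / 3)"
    using pos by (intro mult_left_mono sum_squares_lessThan_le) (auto simp: \<gamma>_def)
  also have "\<dots> = real d * R\<^sup>2"
    unfolding c2 \<gamma>_def using pos by (simp add: power2_eq_square power3_eq_cube field_simps)
  finally have "G / (2 * (\<Sum>s<T. c)) * (real d * R\<^sup>2 + 2 / \<gamma> * ln (1 / \<rho>) + (\<Sum>s<T. c\<^sup>2)
           + \<gamma> * (\<Sum>s<T. c\<^sup>2 * (\<Sum>q<s. c)\<^sup>2)) \<le> G / (2 * (real T * c)) * (4 * (real d * R\<^sup>2))"
    using pos c 2 unfolding 1 by (simp add: mult_left_mono del: times_divide_eq_left)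
  also have "\<dots> = 2 * G * c"
  proof -
    have "real d * R\<^sup>2 = real T * (c * c)" using c2 pos by (simp add: field_simps power2_eq_square)
    then show ?thesis using pos c by simp
  qed
  also have "\<dots> \<le> \<epsilon>"
  proof (rule power2_le_imp_le)
    show "(2 * G * c)\<^sup>2 \<le> \<epsilon>\<^sup>2"
      using T pos by (simp add: power_mult_distrib c2 field_simps)
  qed (use pos in simp)
  finally show ?thesis .
qed

text \<open>Once the scale \<open>x\<close> is at least 1, the ceiling of \<open>4 * x\<close> is at
  most \<open>4 * x + 1\<close>, hence at most \<open>5 * x\<close>, uniformly in all four
  parameters.\<close>

lemma magd_horizon_bigo:
  "(\<lambda>(k, L, r, \<epsilon>). real (magd_horizon k L r \<epsilon>))
     \<in> O[filtercomap (\<lambda>(k, L, r, \<epsilon>). real k * (L * r / \<epsilon>)\<^sup>2) at_top](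
         \<lambda>(k, L, r, \<epsilon>). real k * (L * r / \<epsilon>)\<^sup>2)"
proof (rule bigoI[where c = 5])
  let ?x = "\<lambda>(k, L, r, \<epsilon>). real k * (L * r / \<epsilon>)\<^sup>2"
  have bound: "real (magd_horizon k L r \<epsilon>) \<le> 5 * (real k * (L * r / \<epsilon>)\<^sup>2)"
    if "1 \<le> real k * (L * r / \<epsilon>)\<^sup>2" for k L r \<epsilon>
    using that unfolding magd_horizon_def by linarith
  have "eventually (\<lambda>p. 1 \<le> ?x p) (filtercomap ?x at_top)"
    by (intro eventually_filtercomapI eventually_ge_at_top)
  then show "eventually (\<lambda>p. norm ((\<lambda>(k, L, r, \<epsilon>). real (magd_horizon k L r \<epsilon>)) p) \<le> 5 * norm (?x p))
      (filtercomap ?x at_top)"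
    by (rule eventually_mono) (auto dest: bound)
qed

theorem theorem3p5:
  fixes f :: "real ^ 'n ^ 'm \<Rightarrow> real"
    and W0 Wst :: "real ^ 'n ^ 'm"
    and R G :: real
    and d :: nat
  defines "d \<equiv> min CARD('m) CARD('n)"
  assumes convex: "convex_on UNIV f"
    and dist: "op_norm (W0 - Wst) \<le> R"
    and G_pos: "0 < G"
    and lipschitz: "\<And>X Y. op_norm (X - Wst) \<le> R \<Longrightarrow> op_norm (Y - Wst) \<le> R \<Longrightarrow>
                      \<bar>f X - f Y\<bar> \<le> G * op_norm (X - Y)"
  shows
    "(\<forall>\<eta>bar \<eta> \<gamma> \<rho> \<beta>M \<eta>M \<delta>M \<sigma>M W g calls.
        magd_run f W0 \<eta> \<gamma> \<rho> \<beta>M \<eta>M \<delta>M \<sigma>M W g calls \<and>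
        normalized_steps \<eta>bar g \<eta> \<and>
        (\<forall>t. 0 \<le> \<eta>M t \<and> \<eta>M t \<le> \<eta>bar t / (2 * sqrt (real d)))
        \<longrightarrow>
        (\<forall>t\<ge>1. (MIN s\<in>{..<t}. f (W s)) - f Wst
           \<le> G / (2 * (\<Sum>s<t. \<eta>bar s)) *
              (real d * R\<^sup>2 + 2 / \<gamma> * ln (1 / \<rho>) + (\<Sum>s<t. (\<eta>bar s)\<^sup>2)
               + \<gamma> * (\<Sum>s<t. (\<eta>bar s)\<^sup>2 * (\<Sum>q<s. \<eta>bar q)\<^sup>2))))
     \<and>
     (\<forall>\<epsilon> T \<gamma> \<rho> \<eta>bar \<eta> \<beta>M \<eta>M \<delta>M \<sigma>M W g calls.
        0 < \<epsilon> \<and>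
        T = magd_horizon d G R \<epsilon> \<and>
        \<gamma> = 3 / (real d * R\<^sup>2 * real T) \<and>
        \<rho> = exp (- 3 / (2 * real T)) \<and>
        (\<forall>t. \<eta>bar t = R * sqrt (real d / real T)) \<and>
        (\<forall>t. 0 \<le> \<eta>M t \<and> \<eta>M t \<le> R / (2 * sqrt (real T))) \<and>
        normalized_steps \<eta>bar g \<eta> \<and>
        magd_run f W0 \<eta> \<gamma> \<rho> \<beta>M \<eta>M \<delta>M \<sigma>M W g calls
        \<longrightarrow>
        (\<exists>t'. is_arg_min (\<lambda>t. f (W t)) (\<lambda>t. t < T) t' \<and> f (W t') - f Wst \<le> \<epsilon>) \<and>
        calls T = magd_horizon d G R \<epsilon>)
     \<and>
     (\<lambda>(k, L, r, \<epsilon>). real (magd_horizon k L r \<epsilon>))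
       \<in> O[filtercomap (\<lambda>(k, L, r, \<epsilon>). real k * (L * r / \<epsilon>)\<^sup>2) at_top](
           \<lambda>(k, L, r, \<epsilon>). real k * (L * r / \<epsilon>)\<^sup>2)"
proof (intro conjI allI impI)
  fix \<eta>bar \<eta> \<gamma> \<rho> \<beta>M \<eta>M \<delta>M \<sigma>M W g calls and t :: nat
  assume "magd_run f W0 \<eta> \<gamma> \<rho> \<beta>M \<eta>M \<delta>M \<sigma>M W g calls \<and> normalized_steps \<eta>bar g \<eta> \<and>
      (\<forall>t. 0 \<le> \<eta>M t \<and> \<eta>M t \<le> \<eta>bar t / (2 * sqrt (real d)))" and "1 \<le> t"
  then show "(MIN s\<in>{..<t}. f (W s)) - f Wst
           \<le> G / (2 * (\<Sum>s<t. \<eta>bar s)) *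
              (real d * R\<^sup>2 + 2 / \<gamma> * ln (1 / \<rho>) + (\<Sum>s<t. (\<eta>bar s)\<^sup>2)
               + \<gamma> * (\<Sum>s<t. (\<eta>bar s)\<^sup>2 * (\<Sum>q<s. \<eta>bar q)\<^sup>2))"
    unfolding d_def by (intro magd_best_iterate_le[OF dist G_pos lipschitz]) auto
next
  fix \<epsilon> T \<gamma> \<rho> \<eta>bar \<eta> \<beta>M \<eta>M \<delta>M \<sigma>M W g calls
  assume "0 < \<epsilon> \<and>
        T = magd_horizon d G R \<epsilon> \<and>
        \<gamma> = 3 / (real d * R\<^sup>2 * real T) \<and>
        \<rho> = exp (- 3 / (2 * real T)) \<and>
        (\<forall>t. \<eta>bar t = R * sqrt (real d / real T)) \<and>
        (\<forall>t. 0 \<le> \<eta>M t \<and> \<eta>M t \<le> R / (2 * sqrt (real T))) \<and>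
        normalized_steps \<eta>bar g \<eta> \<and>
        magd_run f W0 \<eta> \<gamma> \<rho> \<beta>M \<eta>M \<delta>M \<sigma>M W g calls"
  then have \<epsilon>: "0 < \<epsilon>" and T: "T = magd_horizon d G R \<epsilon>"
    and \<gamma>: "\<gamma> = 3 / (real d * R\<^sup>2 * real T)" and \<rho>: "\<rho> = exp (- 3 / (2 * real T))"
    and \<eta>bar: "\<And>t. \<eta>bar t = R * sqrt (real d / real T)"
    and \<eta>M: "\<And>t. 0 \<le> \<eta>M t \<and> \<eta>M t \<le> R / (2 * sqrt (real T))"
    and steps: "normalized_steps \<eta>bar g \<eta>"
    and run: "magd_run f W0 \<eta> \<gamma> \<rho> \<beta>M \<eta>M \<delta>M \<sigma>M W g calls"
    by auto
  show "calls T = magd_horizon d G R \<epsilon>" using magd_calls[OF run, of T] T by simp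
  have d: "0 < d" by (simp add: d_def)
  \<comment> \<open>A run requires \<open>0 < \<gamma>\<close>. As division by zero yields 0, the
    formula for \<open>\<gamma>\<close> forces \<open>T\<close> and \<open>R\<close> to be nonzero,
    which excludes the degenerate case \<open>R = 0\<close>.\<close>
  have "\<gamma> \<noteq> 0" using run unfolding magd_run_def magd_inputs_def by auto
  then have "T \<noteq> 0" "R \<noteq> 0" unfolding \<gamma> by auto
  moreover have "0 \<le> R" using dist op_norm_nonneg[of "W0 - Wst"] by linarith
  ultimately have pos: "0 < T" "0 < R" by auto
  have "4 * real d * (G * R / \<epsilon>)\<^sup>2 \<le> real T"
    unfolding T magd_horizon_def by linarith
  note tuned = magd_tuned_bound_le[OF G_pos pos(2) \<epsilon> d pos(1) this]
  \<comment> \<open>With the constant \<open>\<eta>bar\<close> the factor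
    \<open>sqrt (real d)\<close> cancels, so the two caps on \<open>\<eta>M\<close>
    coincide.\<close>
  have "0 \<le> \<eta>M t \<and> \<eta>M t \<le> \<eta>bar t / (2 * sqrt (real (min CARD('m) CARD('n))))" for t
  proof -
    have "\<eta>bar t / (2 * sqrt (real d)) = R / (2 * sqrt (real T))"
      using d by (simp add: \<eta>bar real_sqrt_divide)
    with \<eta>M[of t] show ?thesis unfolding d_def by simp
  qed
  from magd_best_iterate_le[OF dist G_pos lipschitz run steps this, of T] pos(1) tuned
  have gap: "(MIN s\<in>{..<T}. f (W s)) - f Wst \<le> \<epsilon>"
    unfolding \<eta>bar \<gamma> \<rho> d_def by simp
  have ne: "(\<lambda>s. f (W s)) ` {..<T} \<noteq> {}" using pos(1) by auto
  then obtain t' where t': "t' < T" "f (W t') = (MIN s\<in>{..<T}. f (W s))"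
    using Min_in[OF _ ne] by fastforce
  have "f (W t') \<le> f (W s)" if "s < T" for s
    unfolding t'(2) using that by (intro Min_le) auto
  with t'(1) have "is_arg_min (\<lambda>t. f (W t)) (\<lambda>t. t < T) t'"
    by (simp add: is_arg_min_linorder)
  with gap t'(2) show "\<exists>t'. is_arg_min (\<lambda>t. f (W t)) (\<lambda>t. t < T) t' \<and> f (W t') - f Wst \<le> \<epsilon>"
    by (intro exI[of _ t']) simp
qed (rule magd_horizon_bigo)

end
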